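(* Let $a<b$ be real numbers and let $f:[a,b]\to\mathbb{R}$ be convex on $[a,b]$. Then $$0\le\frac{f(a)+f(b)}2-\frac1{b-a}\int_a^b f(t)\,dt\le\frac18\left[f'_-(b)-f'_+(a)\right](b-a),$$ and the constant $\frac18$ is sharp, i.e., it cannot be replaced by a smaller constant so that the second inequality still holds for all convex $f:[a,b]\to\mathbb{R}$.
   Context: $f'_+(a)\in[-\infty,\infty)$ and $f'_-(b)\in(-\infty,+\infty]$ are the right derivative of $f$ at $a$ and the left derivative of $f$ at $b$; if one of them is infinite the right-hand side is $+\infty$. *)

theory Defs
  imports "HOL-Analysis.Analysis"
begin

text \<open>
  One-sided derivatives with values in the extended reals.  A convex function on \<open>{a..b}\<close> may jump
  at an endpoint or have a vertical tangent there; the derivative is then infinite.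
\<close>

definition right_deriv :: "(real \<Rightarrow> real) \<Rightarrow> real \<Rightarrow> ereal" where
  "right_deriv f x = Lim (at_right x) (\<lambda>t. ereal ((f t - f x) / (t - x)))"

definition left_deriv :: "(real \<Rightarrow> real) \<Rightarrow> real \<Rightarrow> ereal" where
  "left_deriv f x = Lim (at_left x) (\<lambda>t. ereal ((f t - f x) / (t - x)))"

text \<open>
  The limits above, and the integral of \<open>f\<close>, exist for every convex \<open>f\<close> on \<open>{a..b}\<close>, so neither
  \<open>Lim\<close> nor \<open>integral\<close> takes an unspecified or default value.
\<close>

lemma convex_on_right_deriv:
  fixes f :: "real \<Rightarrow> real"
  assumes "a < b" and f: "convex_on {a..b} f"
  shows "((\<lambda>t. ereal ((f t - f a) / (t - a))) \<longlongrightarrow> right_deriv f a) (at_right a)"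
    and "right_deriv f a < \<infinity>"
proof -
  let ?q = "\<lambda>t. ereal ((f t - f a) / (t - a))"
  have mono: "?q s \<le> ?q t" if "a < s" "s \<le> t" "t \<le> b" for s t
  proof (cases "s = t")
    case False
    have "(f a - f s) / (a - s) \<le> (f a - f t) / (a - t)"
      by (rule convex_on_slope_le(1)[OF f]) (use that False in auto)
    then show ?thesis
      by (metis ereal_less_eq(3) minus_diff_eq minus_divide_divide)
  qed simp
  have "(?q \<longlongrightarrow> Inf (?q ` ({a<..} \<inter> {..b}))) (at a within ({a<..} \<inter> {..b}))"
    by (rule Lim_right_bound[where K = "-\<infinity>"]) (use mono in auto)
  moreover have "at a within ({a<..} \<inter> {..b}) = at_right a"
    using \<open>a < b\<close> by (intro at_within_nhd[of a "{..<b}"]) auto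
  ultimately have lim: "(?q \<longlongrightarrow> Inf (?q ` ({a<..} \<inter> {..b}))) (at_right a)"
    by simp
  then have eq: "right_deriv f a = Inf (?q ` ({a<..} \<inter> {..b}))"
    unfolding right_deriv_def by (intro tendsto_Lim) auto
  show "(?q \<longlongrightarrow> right_deriv f a) (at_right a)"
    using lim eq by simp
  have "right_deriv f a \<le> ?q b"
    unfolding eq by (rule Inf_lower) (use \<open>a < b\<close> in auto)
  then show "right_deriv f a < \<infinity>"
    using less_ereal.simps(4) le_less_trans by blast
qed

lemma convex_on_left_deriv:
  fixes f :: "real \<Rightarrow> real"
  assumes "a < b" and f: "convex_on {a..b} f"
  shows "((\<lambda>t. ereal ((f t - f b) / (t - b))) \<longlongrightarrow> left_deriv f b) (at_left b)"
    and "- \<infinity> < left_deriv f b"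
proof -
  let ?q = "\<lambda>t. ereal ((f t - f b) / (t - b))"
  have mono: "?q s \<le> ?q t" if "a \<le> s" "s \<le> t" "t < b" for s t
  proof (cases "s = t")
    case False
    have "(f s - f b) / (s - b) \<le> (f t - f b) / (t - b)"
      by (rule convex_on_slope_le(2)[OF f]) (use that False in auto)
    then show ?thesis by simp
  qed simp
  have "(?q \<longlongrightarrow> Sup (?q ` ({..<b} \<inter> {a..}))) (at b within ({..<b} \<inter> {a..}))"
    by (rule Lim_left_bound[where K = "\<infinity>"]) (use mono in auto)
  moreover have "at b within ({..<b} \<inter> {a..}) = at_left b"
    using \<open>a < b\<close> by (intro at_within_nhd[of b "{a<..}"]) auto
  ultimately have lim: "(?q \<longlongrightarrow> Sup (?q ` ({..<b} \<inter> {a..}))) (at_left b)"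
    by simp
  then have eq: "left_deriv f b = Sup (?q ` ({..<b} \<inter> {a..}))"
    unfolding left_deriv_def by (intro tendsto_Lim) auto
  show "(?q \<longlongrightarrow> left_deriv f b) (at_left b)"
    using lim eq by simp
  have "?q a \<le> left_deriv f b"
    unfolding eq by (rule Sup_upper) (use \<open>a < b\<close> in auto)
  then show "- \<infinity> < left_deriv f b"
    using less_ereal.simps(5) less_le_trans by blast
qed

lemma convex_on_integrable:
  fixes f :: "real \<Rightarrow> real"
  assumes f: "convex_on {a..b} f"
  shows "f integrable_on {a..b}"
proof -
  define M where "M = max (f a) (f b)"
  define B where "B = \<bar>M\<bar> + 2 * \<bar>f ((a + b) / 2)\<bar>"
  have up: "f x \<le> M" if "x \<in> {a..b}" for x
  proof -
    have "x \<in> convex hull {a, b}"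
      using that by (auto simp: segment_convex_hull[symmetric] closed_segment_eq_real_ivl)
    moreover have "convex_on (convex hull {a, b}) f"
      using f that by (auto simp: segment_convex_hull[symmetric] closed_segment_eq_real_ivl)
    ultimately show ?thesis
      using convex_on_convex_hull_bound[of "{a, b}" f M] by (auto simp: M_def)
  qed
  have bound: "norm (f x) \<le> B" if x: "x \<in> {a..b}" for x
  proof -
    have x': "a + b - x \<in> {a..b}" using x by auto
    have "f ((1 - 1/2) *\<^sub>R x + (1/2) *\<^sub>R (a + b - x)) \<le> (1 - 1/2) * f x + (1/2) * f (a + b - x)"
      by (rule convex_onD[OF f]) (use x x' in auto)
    also have "(1 - 1/2) *\<^sub>R x + (1/2) *\<^sub>R (a + b - x) = (a + b) / 2"
      by (simp add: field_simps)
    finally have "2 * f ((a + b) / 2) \<le> f x + f (a + b - x)" by simp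
    with up[OF x] up[OF x'] show ?thesis unfolding B_def by simp
  qed
  have "convex_on {a<..<b} f"
    by (rule convex_on_subset[OF f]) auto
  then have "continuous_on {a<..<b} f"
    by (intro convex_on_continuous) auto
  then have "f \<in> borel_measurable (lebesgue_on {a<..<b})"
    by (intro continuous_imp_measurable_on_sets_lebesgue) auto
  then have "f integrable_on {a<..<b}"
    by (rule measurable_bounded_by_integrable_imp_integrable[where g = "\<lambda>_. B"])
       (use bound in \<open>auto simp: integrable_on_open_interval_real\<close>)
  then show ?thesis
    by (simp add: integrable_on_open_interval_real)
qed

end

theory Submission
  imports Defs
begin

text \<open>
  A convex \<open>f\<close> lies below its chord, which gives the first inequality.  For the second, \<open>f\<close> lies
  above its one-sided tangents at \<open>a\<close> and at \<open>b\<close>; integrate the former over the left half of the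
  interval and the latter over the right half.  Equality holds for \<open>\<lambda>t. \<bar>t - (a + b) / 2\<bar>\<close>.
\<close>

text \<open>The base point \<open>u\<close> is left free so that the chord, the tangents at both
  endpoints and the two branches of an absolute value are all instances.\<close>

lemma has_integral_affine:
  fixes c d p q u :: real
  assumes "c \<le> d"
  shows "((\<lambda>t. p + q * (t - u)) has_integral (p * (d - c) + q / 2 * ((d - u)\<^sup>2 - (c - u)\<^sup>2))) {c..d}"
proof -
  let ?F = "\<lambda>t. p * t + q / 2 * (t - u)\<^sup>2"
  have "((\<lambda>t. p + q * (t - u)) has_integral (?F d - ?F c)) {c..d}"
    by (rule fundamental_theorem_of_calculus[OF assms])
       (auto intro!: derivative_eq_intros simp flip: has_real_derivative_iff_has_vector_derivative)
  then show ?thesis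
    by (simp add: algebra_simps)
qed

text \<open>Slopes of chords from \<open>a\<close> increase with the other endpoint, so their limit
  at \<open>a\<close> is at most each of them. When the limit is finite, multiplying by
  \<open>t - a\<close> > 0 puts \<open>f\<close> above its tangent at \<open>a\<close>.\<close>

lemma right_deriv_le_slope:
  fixes f :: "real \<Rightarrow> real"
  assumes f: "convex_on {a..b} f" and t: "a < t" "t \<le> b"
  shows "right_deriv f a \<le> ereal ((f t - f a) / (t - a))"
proof (rule tendsto_upperbound)
  show "((\<lambda>s. ereal ((f s - f a) / (s - a))) \<longlongrightarrow> right_deriv f a) (at_right a)"
    using convex_on_right_deriv(1)[OF _ f] t by simp
  have "(f s - f a) / (s - a) \<le> (f t - f a) / (t - a)" if "a < s" "s < t" for s
  proof -
    have "(f a - f s) / (a - s) \<le> (f a - f t) / (a - t)"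
      by (rule convex_on_slope_le(1)[OF f]) (use that t in auto)
    then show ?thesis
      by (metis minus_diff_eq minus_divide_divide)
  qed
  then show "\<forall>\<^sub>F s in at_right a. ereal ((f s - f a) / (s - a)) \<le> ereal ((f t - f a) / (t - a))"
    using t(1) by (auto simp: eventually_at_right)
qed simp

text \<open>The mirror image at \<open>b\<close>. Here \<open>t - b\<close> < 0, so clearing the
  denominator reverses the inequality and again puts \<open>f\<close> above its tangent.\<close>

lemma slope_le_left_deriv:
  fixes f :: "real \<Rightarrow> real"
  assumes f: "convex_on {a..b} f" and t: "a \<le> t" "t < b"
  shows "ereal ((f t - f b) / (t - b)) \<le> left_deriv f b"
proof (rule tendsto_lowerbound)
  show "((\<lambda>s. ereal ((f s - f b) / (s - b))) \<longlongrightarrow> left_deriv f b) (at_left b)"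
    using convex_on_left_deriv(1)[OF _ f] t by simp
  have "(f t - f b) / (t - b) \<le> (f s - f b) / (s - b)" if "t < s" "s < b" for s
    by (rule convex_on_slope_le(2)[OF f]) (use that t in auto)
  then show "\<forall>\<^sub>F s in at_left b. ereal ((f t - f b) / (t - b)) \<le> ereal ((f s - f b) / (s - b))"
    using t(2) by (auto simp: eventually_at_left)
qed simp

lemma convex_on_integral_le_trapezoid:
  fixes f :: "real \<Rightarrow> real"
  assumes ab: "a < b" and f: "convex_on {a..b} f"
  shows "integral {a..b} f \<le> (b - a) * ((f a + f b) / 2)"
proof -
  define q where "q = (f b - f a) / (b - a)"
  \<comment> \<open>The bound keeps \<open>(a - a)\<^sup>2\<close> because this is the integral of
    the chord as \<open>has_integral_affine\<close> yields it with \<open>u = a\<close>.\<close>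
  have "integral {a..b} f \<le> f a * (b - a) + q / 2 * ((b - a)\<^sup>2 - (a - a)\<^sup>2)"
  proof (rule has_integral_le[OF integrable_integral[OF convex_on_integrable[OF f]] has_integral_affine])
    show "f t \<le> f a + q * (t - a)" if "t \<in> {a..b}" for t
      using convex_onD_Icc'[OF f that] by (simp add: q_def)
  qed (use ab in simp)
  also have "\<dots> = (b - a) * ((f a + f b) / 2)"
    using ab by (simp add: q_def power2_eq_square field_simps)
  finally show ?thesis .
qed

text \<open>Cutting at the midpoint gives \<open>f a\<close> and \<open>f b\<close> the same weight
  \<open>(b - a) / 2\<close>, as in the trapezoid. The linear parts integrate to
  \<open>R * (b - a)\<^sup>2 / 8\<close> and \<open>- L * (b - a)\<^sup>2 / 8\<close>, which is
  where the constant 1/8 comes from.\<close>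

lemma convex_on_integral_ge_tangents:
  fixes f :: "real \<Rightarrow> real"
  assumes ab: "a < b" and f: "convex_on {a..b} f"
    and L: "left_deriv f b = ereal L" and R: "right_deriv f a = ereal R"
  shows "(b - a) * ((f a + f b) / 2) - (L - R) * (b - a)\<^sup>2 / 8 \<le> integral {a..b} f"
proof -
  define m where "m = (a + b) / 2"
  have m: "a \<le> m" "m \<le> b" using ab by (auto simp: m_def)
  note int = convex_on_integrable[OF f]
  have "f a * (m - a) + R / 2 * ((m - a)\<^sup>2 - (a - a)\<^sup>2) \<le> integral {a..m} f"
  proof (rule has_integral_le[OF has_integral_affine integrable_integral])
    show "f integrable_on {a..m}"
      by (rule integrable_subinterval_real[OF int]) (use m in auto)
    show "f a + R * (t - a) \<le> f t" if "t \<in> {a..m}" for t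
      \<comment> \<open>At \<open>t = a\<close> there is no slope to compare, but the tangent meets
        \<open>f\<close> there.\<close>
      using right_deriv_le_slope[OF f, of t] that m
      by (cases "t = a") (auto simp: R field_simps)
  qed (use m in simp)
  moreover have "f b * (b - m) + L / 2 * ((b - b)\<^sup>2 - (m - b)\<^sup>2) \<le> integral {m..b} f"
  proof (rule has_integral_le[OF has_integral_affine integrable_integral])
    show "f integrable_on {m..b}"
      by (rule integrable_subinterval_real[OF int]) (use m in auto)
    show "f b + L * (t - b) \<le> f t" if "t \<in> {m..b}" for t
      using slope_le_left_deriv[OF f, of t] that m
      by (cases "t = b") (auto simp: L field_simps)
  qed (use m in simp)
  moreover have "integral {a..m} f + integral {m..b} f = integral {a..b} f"
    by (rule Henstock_Kurzweil_Integration.integral_combine[OF m int])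
  moreover have "f a * (m - a) + R / 2 * ((m - a)\<^sup>2 - (a - a)\<^sup>2)
      + (f b * (b - m) + L / 2 * ((b - b)\<^sup>2 - (m - b)\<^sup>2))
      = (b - a) * ((f a + f b) / 2) - (L - R) * (b - a)\<^sup>2 / 8"
    by (simp add: m_def power2_eq_square field_simps)
  ultimately show ?thesis by linarith
qed

text \<open>Between the kink \<open>m\<close> and \<open>x\<close> the difference quotient is
  constant, so both limits are limits of eventually constant functions.\<close>

lemma
  fixes m x :: real
  shows left_deriv_abs: "m < x \<Longrightarrow> left_deriv (\<lambda>t. \<bar>t - m\<bar>) x = 1"
    and right_deriv_abs: "x < m \<Longrightarrow> right_deriv (\<lambda>t. \<bar>t - m\<bar>) x = -1"
proof -
  assume x: "m < x"
  have "\<forall>\<^sub>F t in at_left x. ereal ((\<bar>t - m\<bar> - \<bar>x - m\<bar>) / (t - x)) = 1"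
    unfolding eventually_at_left[OF x] using x by (intro exI[of _ m]) (auto simp: one_ereal_def)
  then have "((\<lambda>t. ereal ((\<bar>t - m\<bar> - \<bar>x - m\<bar>) / (t - x))) \<longlongrightarrow> 1) (at_left x)"
    by (rule tendsto_eventually)
  then show "left_deriv (\<lambda>t. \<bar>t - m\<bar>) x = 1"
    unfolding left_deriv_def by (intro tendsto_Lim) auto
next
  assume x: "x < m"
  have "(\<bar>t - m\<bar> - \<bar>x - m\<bar>) / (t - x) = -1" if "x < t" "t < m" for t
    using that by (simp add: field_simps)
  then have "\<forall>\<^sub>F t in at_right x. ereal ((\<bar>t - m\<bar> - \<bar>x - m\<bar>) / (t - x)) = -1"
    unfolding eventually_at_right[OF x] using x by (intro exI[of _ m]) (auto simp: one_ereal_def)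
  then have "((\<lambda>t. ereal ((\<bar>t - m\<bar> - \<bar>x - m\<bar>) / (t - x))) \<longlongrightarrow> -1) (at_right x)"
    by (rule tendsto_eventually)
  then show "right_deriv (\<lambda>t. \<bar>t - m\<bar>) x = -1"
    unfolding right_deriv_def by (intro tendsto_Lim) auto
qed

text \<open>The graph bounds two right triangles with both legs \<open>(b - a) / 2\<close>, each of
  area \<open>(b - a)\<^sup>2 / 8\<close>.\<close>

lemma has_integral_abs_midpoint:
  fixes a b :: real
  assumes "a < b"
  shows "((\<lambda>t. \<bar>t - (a + b) / 2\<bar>) has_integral (b - a)\<^sup>2 / 4) {a..b}"
proof -
  define m where "m = (a + b) / 2"
  have m: "a \<le> m" "m \<le> b" using assms by (auto simp: m_def)
  \<comment> \<open>On each half the function is affine: \<open>p = 0\<close>, \<open>u = m\<close>,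
    and \<open>q\<close> is -1 to the left of \<open>m\<close> and 1 to the right.\<close>
  have "((\<lambda>t. \<bar>t - m\<bar>) has_integral (0 * (m - a) + -1 / 2 * ((m - m)\<^sup>2 - (a - m)\<^sup>2))) {a..m}"
    by (rule has_integral_eq[OF _ has_integral_affine[OF m(1)]]) auto
  moreover have "((\<lambda>t. \<bar>t - m\<bar>) has_integral (0 * (b - m) + 1 / 2 * ((b - m)\<^sup>2 - (m - m)\<^sup>2))) {m..b}"
    by (rule has_integral_eq[OF _ has_integral_affine[OF m(2)]]) auto
  ultimately have "((\<lambda>t. \<bar>t - m\<bar>) has_integral
      (0 * (m - a) + -1 / 2 * ((m - m)\<^sup>2 - (a - m)\<^sup>2)
       + (0 * (b - m) + 1 / 2 * ((b - m)\<^sup>2 - (m - m)\<^sup>2)))) {a..b}"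
    by (rule has_integral_combine[OF m])
  also have "0 * (m - a) + -1 / 2 * ((m - m)\<^sup>2 - (a - m)\<^sup>2)
       + (0 * (b - m) + 1 / 2 * ((b - m)\<^sup>2 - (m - m)\<^sup>2)) = (b - a)\<^sup>2 / 4"
    by (simp add: m_def power2_eq_square field_simps)
  finally show ?thesis by (simp add: m_def)
qed

theorem corollary3:
  fixes a b :: real
  assumes "a < b"
  shows "(\<forall>f :: real \<Rightarrow> real. convex_on {a..b} f \<longrightarrow>
            0 \<le> (f a + f b) / 2 - 1 / (b - a) * integral {a..b} f \<and>
            ereal ((f a + f b) / 2 - 1 / (b - a) * integral {a..b} f)
              \<le> ereal (1 / 8) * (left_deriv f b - right_deriv f a) * ereal (b - a))
       \<and> (\<forall>c :: real. c < 1 / 8 \<longrightarrow>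
            \<not> (\<forall>f :: real \<Rightarrow> real. convex_on {a..b} f \<longrightarrow>
                  ereal ((f a + f b) / 2 - 1 / (b - a) * integral {a..b} f)
                    \<le> ereal c * (left_deriv f b - right_deriv f a) * ereal (b - a)))"
proof (intro conjI allI impI)
  fix f :: "real \<Rightarrow> real"
  assume f: "convex_on {a..b} f"
  show "0 \<le> (f a + f b) / 2 - 1 / (b - a) * integral {a..b} f"
    using convex_on_integral_le_trapezoid[OF assms f] assms by (simp add: field_simps)
  show "ereal ((f a + f b) / 2 - 1 / (b - a) * integral {a..b} f)
      \<le> ereal (1 / 8) * (left_deriv f b - right_deriv f a) * ereal (b - a)"
  proof (cases "left_deriv f b = \<infinity> \<or> right_deriv f a = -\<infinity>")
    case True
    \<comment> \<open>The left derivative at \<open>b\<close> is never -\<infinity> and the right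
      derivative at \<open>a\<close> never \<infinity>, so no undetermined difference arises. The
      factors 1/8 and \<open>b - a\<close> are positive, hence the whole right-hand side is
      \<infinity>.\<close>
    then have "left_deriv f b - right_deriv f a = \<infinity>"
      using convex_on_right_deriv(2)[OF assms f] convex_on_left_deriv(2)[OF assms f]
      by (cases "left_deriv f b"; cases "right_deriv f a") auto
    then show ?thesis
      using assms by simp
  next
    case False
    then obtain L R where L: "left_deriv f b = ereal L" and R: "right_deriv f a = ereal R"
      using convex_on_right_deriv(2)[OF assms f] convex_on_left_deriv(2)[OF assms f]
      by (cases "left_deriv f b"; cases "right_deriv f a") auto
    have "((b - a) * ((f a + f b) / 2) - (L - R) * (b - a)\<^sup>2 / 8) / (b - a)
        \<le> 1 / (b - a) * integral {a..b} f"
      unfolding times_divide_eq_left mult_1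
      using convex_on_integral_ge_tangents[OF assms f L R] assms by (intro divide_right_mono) auto
    moreover have "((b - a) * ((f a + f b) / 2) - (L - R) * (b - a)\<^sup>2 / 8) / (b - a)
        = (f a + f b) / 2 - 1 / 8 * (L - R) * (b - a)"
    proof -
      \<comment> \<open>A single variable \<open>d\<close> stands for \<open>b - a\<close>, so that
        the cancellation does not have to deal with a difference.\<close>
      have "(d * s - e * d\<^sup>2 / 8) / d = s - 1 / 8 * e * d" if "d \<noteq> 0" for d s e :: real
        using that by (simp add: field_simps power2_eq_square)
      then show ?thesis by this (use assms in simp)
    qed
    ultimately have "(f a + f b) / 2 - 1 / (b - a) * integral {a..b} f \<le> 1 / 8 * (L - R) * (b - a)"
      by linarith
    then show ?thesis
      by (simp only: L R ereal_minus(1) times_ereal.simps(1) ereal_less_eq(3))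
  qed
next
  fix c :: real
  assume c: "c < 1 / 8"
  \<comment> \<open>One witness refutes every \<open>c\<close>: its trapezoid error is
    \<open>(b - a) / 4\<close>, and its end slopes -1 and 1 make the right-hand side
    \<open>c * 2 * (b - a)\<close>, which is smaller exactly when \<open>c < 1 / 8\<close>.\<close>
  define m where "m = (a + b) / 2"
  define f where "f = (\<lambda>t. \<bar>t - m\<bar>)"
  have m: "a < m" "m < b" using assms by (auto simp: m_def)
  have "convex_on {a..b} f"
    using convex_on_dist[of "{a..b}" m] by (simp add: f_def dist_real_def abs_minus_commute)
  moreover have "integral {a..b} f = (b - a)\<^sup>2 / 4"
    using has_integral_abs_midpoint[OF assms] by (simp add: f_def m_def integral_unique)
  then have "(f a + f b) / 2 - 1 / (b - a) * integral {a..b} f = (b - a) / 4"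
    using assms by (simp add: f_def m_def power2_eq_square field_simps)
  moreover have "left_deriv f b - right_deriv f a = ereal 2"
    using m by (simp add: f_def left_deriv_abs right_deriv_abs one_ereal_def)
  moreover have "c * 2 * (b - a) < (b - a) / 4"
    using mult_strict_right_mono[OF c, of "b - a"] assms by simp
  ultimately have "\<not> (convex_on {a..b} f \<longrightarrow>
      ereal ((f a + f b) / 2 - 1 / (b - a) * integral {a..b} f)
        \<le> ereal c * (left_deriv f b - right_deriv f a) * ereal (b - a))"
    by (simp only: times_ereal.simps(1) ereal_less_eq(3) not_le simp_thms)
  then show "\<not> (\<forall>f :: real \<Rightarrow> real. convex_on {a..b} f \<longrightarrow>
      ereal ((f a + f b) / 2 - 1 / (b - a) * integral {a..b} f)
        \<le> ereal c * (left_deriv f b - right_deriv f a) * ereal (b - a))"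
    by blast
qed

end
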